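(* For $\boldsymbol\theta=(a,\delta)^\top$ with $a\in\mathbb R\setminus\{0\}$ and $\delta>0$, let $f_{\boldsymbol\theta}$ be the generalized spectrum of the (possibly non-invertible) Cauchy MA(1) process $Z_t=\epsilon_t-a^{-1}\epsilon_{t-1}$, $t\in\mathbb Z$, where $\{\epsilon_t\}$ is i.i.d. centered Cauchy with scale parameter $\delta$. Then $\boldsymbol\theta$ is identifiable from the generalized spectrum: if $\boldsymbol\theta=(a,\delta)^\top$ and $\boldsymbol\theta'=(a',\delta')^\top$ are two such parameters with $f_{\boldsymbol\theta}(\lambda;u,v)=f_{\boldsymbol\theta'}(\lambda;u,v)$ for all $\lambda\in[0,2\pi]$ and $(u,v)\in[-\pi,\pi]^2$, then $\boldsymbol\theta=\boldsymbol\theta'$.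
   Context: The generalized spectrum of a strictly stationary process $\{Z_t\}$ is $$f(\lambda;u,v)=\frac1{2\pi}\sum_{\ell=-\infty}^\infty\bigl\{{\rm E}(e^{iuZ_{t+\ell}+ivZ_t})-{\rm E}(e^{iuZ_{t+\ell}}){\rm E}(e^{ivZ_t})\bigr\}e^{-i\ell\lambda},\quad\lambda\in\mathbb R,\ (u,v)\in\mathbb R^2.$$ A centered Cauchy variable with scale parameter $\delta>0$ has characteristic function $s\mapsto e^{-\delta|s|}$. *)

theory Defs
  imports "HOL-Probability.Probability"
begin

definition strictly_stationary :: "'w measure \<Rightarrow> (int \<Rightarrow> 'w \<Rightarrow> real) \<Rightarrow> bool" where
  "strictly_stationary M Z \<longleftrightarrow>
     (\<forall>t. Z t \<in> borel_measurable M) \<and>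
     (\<forall>h. distr M (\<Pi>\<^sub>M t\<in>UNIV. borel) (\<lambda>w t. Z (t + h) w) = distr M (\<Pi>\<^sub>M t\<in>UNIV. borel) (\<lambda>w t. Z t w))"

definition gen_cov :: "'w measure \<Rightarrow> (int \<Rightarrow> 'w \<Rightarrow> real) \<Rightarrow> int \<Rightarrow> int \<Rightarrow> real \<Rightarrow> real \<Rightarrow> complex" where
  "gen_cov M Z t l u v =
     (CLINT w|M. iexp (u * Z (t + l) w + v * Z t w))
     - (CLINT w|M. iexp (u * Z (t + l) w)) * (CLINT w|M. iexp (v * Z t w))"

(* The generalized spectrum is meant for strictly stationary processes. For these gen_cov does not
   depend on the base time (gen_cov_stationary below), so the base time is taken to be 0. *)
definition gen_spectrum :: "'w measure \<Rightarrow> (int \<Rightarrow> 'w \<Rightarrow> real) \<Rightarrow> real \<Rightarrow> real \<Rightarrow> real \<Rightarrow> complex" where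
  "gen_spectrum M Z lam u v =
     complex_of_real (1 / (2 * pi)) *
       (\<Sum>\<^sub>\<infinity>l\<in>UNIV. gen_cov M Z 0 l u v * iexp (- (real_of_int l * lam)))"

(* A law on the reals is determined by its characteristic function (Levy_uniqueness). *)
definition centered_cauchy :: "'w measure \<Rightarrow> real \<Rightarrow> ('w \<Rightarrow> real) \<Rightarrow> bool" where
  "centered_cauchy M \<delta> X \<longleftrightarrow>
     X \<in> borel_measurable M \<and> (\<forall>s. char (distr M borel X) s = complex_of_real (exp (- \<delta> * \<bar>s\<bar>)))"

definition iid_cauchy :: "'w measure \<Rightarrow> real \<Rightarrow> (int \<Rightarrow> 'w \<Rightarrow> real) \<Rightarrow> bool" where
  "iid_cauchy M \<delta> \<epsilon> \<longleftrightarrow>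
     prob_space M \<and> prob_space.indep_vars M (\<lambda>_. borel) \<epsilon> UNIV \<and> (\<forall>t. centered_cauchy M \<delta> (\<epsilon> t))"

definition ma1 :: "real \<Rightarrow> (int \<Rightarrow> 'w \<Rightarrow> real) \<Rightarrow> int \<Rightarrow> 'w \<Rightarrow> real" where
  "ma1 a \<epsilon> t w = \<epsilon> t w - inverse a * \<epsilon> (t - 1) w"

lemma gen_cov_stationary:
  assumes "strictly_stationary M Z"
  shows "gen_cov M Z t l u v = gen_cov M Z 0 l u v"
proof -
  have Z [measurable]: "\<And>t. Z t \<in> borel_measurable M"
    and eq: "distr M (\<Pi>\<^sub>M t\<in>UNIV. borel) (\<lambda>w s. Z (s + t) w) = distr M (\<Pi>\<^sub>M t\<in>UNIV. borel) (\<lambda>w t. Z t w)"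
    using assms by (auto simp: strictly_stationary_def)
  have *: "(CLINT w|M. iexp (p * Z (t + l) w + q * Z t w)) = (CLINT w|M. iexp (p * Z l w + q * Z 0 w))"
    for p q
  proof -
    have m: "(\<lambda>w s. Z (s + h) w) \<in> measurable M (\<Pi>\<^sub>M t\<in>UNIV. borel)" for h
      by (rule measurable_PiM_single') auto
    let ?g = "\<lambda>x. iexp (p * x l + q * x (0::int))"
    have g: "?g \<in> borel_measurable (\<Pi>\<^sub>M t\<in>UNIV. borel)" by measurable
    have "(CLINT w|M. iexp (p * Z (t + l) w + q * Z t w)) = (CLINT x|distr M (\<Pi>\<^sub>M t\<in>UNIV. borel) (\<lambda>w s. Z (s + t) w). ?g x)"
      by (subst integral_distr[OF m g]) (simp add: add.commute)
    also have "\<dots> = (CLINT w|M. iexp (p * Z l w + q * Z 0 w))"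
      unfolding eq by (subst integral_distr[OF m[of 0, simplified] g]) simp
    finally show ?thesis .
  qed
  from *[of u v] *[of u 0] *[of 0 v] show ?thesis
    by (simp add: gen_cov_def)
qed

lemma strictly_stationary_ma1:
  assumes "iid_cauchy M \<delta> \<epsilon>"
  shows "strictly_stationary M (ma1 a \<epsilon>)"
proof -
  interpret prob_space M using assms by (simp add: iid_cauchy_def)
  let ?P = "(\<Pi>\<^sub>M t\<in>UNIV. borel) :: (int \<Rightarrow> real) measure"
  have e [measurable]: "\<And>t. \<epsilon> t \<in> borel_measurable M"
    and ind: "indep_vars (\<lambda>_. borel) \<epsilon> UNIV"
    and ch: "\<And>t s. char (distr M borel (\<epsilon> t)) s = complex_of_real (exp (- \<delta> * \<bar>s\<bar>))"
    using assms by (auto simp: iid_cauchy_def centered_cauchy_def)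
  have m: "(\<lambda>w t. \<epsilon> (t + h) w) \<in> measurable M ?P" for h
    by (rule measurable_PiM_single') auto
  have id: "distr M borel (\<epsilon> s) = distr M borel (\<epsilon> t)" for s t
    by (rule Levy_uniqueness) (auto intro!: real_distribution_distr simp: ch fun_eq_iff)
  have law: "distr M ?P (\<lambda>w t. \<epsilon> (t + h) w) = (\<Pi>\<^sub>M t\<in>UNIV. distr M borel (\<epsilon> 0))" for h
  proof -
    have ps: "prob_space (distr M borel (\<epsilon> 0))" by (rule prob_space_distr) simp
    have 0: "distr M ?P (\<lambda>w t. \<epsilon> t w) = (\<Pi>\<^sub>M t\<in>UNIV. distr M borel (\<epsilon> t))"
      using ind by (subst (asm) indep_vars_iff_distr_eq_PiM) (auto simp: restrict_def)
    have id': "(\<lambda>t. distr M borel (\<epsilon> t)) = (\<lambda>t. distr M borel (\<epsilon> 0))"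
      using id by blast
    have "distr M ?P (\<lambda>w t. \<epsilon> (t + h) w) = distr (distr M ?P (\<lambda>w t. \<epsilon> t w)) ?P (\<lambda>x t. x (t + h))"
      using m[of 0]
      by (subst distr_distr) (auto simp: comp_def intro!: measurable_PiM_single')
    also have "\<dots> = distr (\<Pi>\<^sub>M t\<in>UNIV. distr M borel (\<epsilon> 0)) (\<Pi>\<^sub>M t\<in>UNIV. distr M borel (\<epsilon> 0)) (\<lambda>x t. x (t + h))"
      unfolding 0 id' by (intro distr_cong refl sets_PiM_cong) simp
    also have "\<dots> = (\<Pi>\<^sub>M t\<in>UNIV. distr M borel (\<epsilon> 0))"
      using distr_PiM_reindex[of UNIV "\<lambda>_. distr M borel (\<epsilon> 0)" "\<lambda>t. t + h" UNIV] ps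
      by (simp add: inj_on_def restrict_def)
    finally show ?thesis .
  qed
  let ?g = "\<lambda>x t. x t - inverse a * x (t - 1 :: int)"
  have g: "?g \<in> measurable ?P ?P"
    by (rule measurable_PiM_single') auto
  have "distr M ?P (\<lambda>w t. ma1 a \<epsilon> (t + h) w) = distr (distr M ?P (\<lambda>w t. \<epsilon> (t + h) w)) ?P ?g" for h
    by (subst distr_distr[OF g m]) (simp add: comp_def ma1_def algebra_simps)
  then have *: "distr M ?P (\<lambda>w t. ma1 a \<epsilon> (t + h) w) = distr (\<Pi>\<^sub>M t\<in>UNIV. distr M borel (\<epsilon> 0)) ?P ?g" for h
    by (simp only: law)
  have "ma1 a \<epsilon> t \<in> borel_measurable M" for t
    unfolding ma1_def by measurable
  with * *[of 0] show ?thesis by (simp add: strictly_stationary_def)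
qed

end

theory Submission
  imports Defs
begin

text \<open>
  The noise is independent, so the characteristic function of any finite linear combination
  of its values is explicit. Hence the generalized autocovariances \<open>\<gamma>\<^sub>l(u, v)\<close> of the MA(1) process are
  known: they vanish for \<open>\<bar>l\<bar> \<ge> 2\<close>, because then the two values of the process share no noise term,
  and with \<open>D = \<delta> / a\<close>

    \<open>\<gamma>\<^sub>0(u, v) = exp (- (\<delta> + \<bar>D\<bar>) \<bar>u + v\<bar>) - exp (- (\<delta> + \<bar>D\<bar>) (\<bar>u\<bar> + \<bar>v\<bar>))\<close>,

    \<open>\<gamma>\<^sub>1(u, v) = exp (- (\<delta> \<bar>u\<bar> + \<bar>\<delta> v - D u\<bar> + \<bar>D v\<bar>)) - exp (- (\<delta> + \<bar>D\<bar>) (\<bar>u\<bar> + \<bar>v\<bar>))\<close>.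

  The spectrum is a trigonometric polynomial of degree one in the frequency, and its values at
  \<open>0\<close>, \<open>\<pi> / 2\<close> and \<open>\<pi>\<close> recover \<open>\<gamma>\<^sub>0\<close> and \<open>\<gamma>\<^sub>1\<close>. Now \<open>\<gamma>\<^sub>0(1, -1)\<close> determines
  \<open>\<delta> + \<bar>D\<bar>\<close>, the scale parameter of the marginal law. After that, \<open>\<gamma>\<^sub>1(1, x)\<close> determines
  \<open>\<delta> + \<bar>\<delta> x - D\<bar> + \<bar>D x\<bar>\<close>. As a function of \<open>x\<close> this is piecewise linear with kinks at \<open>0\<close>
  and at \<open>D / \<delta> = 1 / a\<close>, of slope change \<open>2 \<bar>D\<bar>\<close> and \<open>2 \<delta>\<close>; the kink away from \<open>0\<close> reveals \<open>a\<close>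
  and \<open>\<delta>\<close>, and so separates \<open>a\<close> from \<open>1 / a\<close>. The values at \<open>x = \<plusminus>1\<close> and \<open>x = \<plusminus>2\<close>,
  all of which lie in \<open>[-\<pi>, \<pi>]\<close>, already suffice (\<open>kink_parameters_determined\<close>).
\<close>

text \<open>
  The only place where independence and the Cauchy law enter: the characteristic function of a sum
  of independent variables is a product, and a centered Cauchy law scaled by \<open>c\<close> is again centered
  Cauchy, with scale parameter multiplied by \<open>\<bar>c\<bar>\<close>. All expectations below are instances, obtained
  by collecting the coefficient of each noise term.
\<close>
lemma iid_cauchy_iexp_linear_combination:
  fixes c :: "int \<Rightarrow> real"
  assumes iid: "iid_cauchy M \<delta> \<epsilon>" and fin: "finite T"
  shows "(CLINT w|M. iexp (\<Sum>t\<in>T. c t * \<epsilon> t w))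
    = complex_of_real (exp (- (\<delta> * (\<Sum>t\<in>T. \<bar>c t\<bar>))))"
proof -
  interpret prob_space M using iid by (simp add: iid_cauchy_def)
  have meas [measurable]: "\<And>t. \<epsilon> t \<in> borel_measurable M"
    and ind: "indep_vars (\<lambda>_. borel) \<epsilon> UNIV"
    and ch: "\<And>t s. char (distr M borel (\<epsilon> t)) s = complex_of_real (exp (- \<delta> * \<bar>s\<bar>))"
    using iid by (auto simp: iid_cauchy_def centered_cauchy_def)
  have ind': "indep_vars (\<lambda>_. borel) (\<lambda>t w. c t * \<epsilon> t w) T"
    by (rule indep_vars_compose2[OF indep_vars_subset[OF ind]]) auto
  have scaled: "char (distr M borel (\<lambda>w. c t * \<epsilon> t w)) 1 = complex_of_real (exp (- \<delta> * \<bar>c t\<bar>))" for t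
    using ch[of t "c t"] by (simp add: char_def integral_distr)
  have "(CLINT w|M. iexp (\<Sum>t\<in>T. c t * \<epsilon> t w))
      = char (distr M borel (\<lambda>w. \<Sum>t\<in>T. c t * \<epsilon> t w)) 1"
    by (simp add: char_def integral_distr)
  also have "\<dots> = (\<Prod>t\<in>T. complex_of_real (exp (- \<delta> * \<bar>c t\<bar>)))"
    by (simp only: char_distr_sum[OF ind'] scaled)
  also have "\<dots> = complex_of_real (exp (- (\<delta> * (\<Sum>t\<in>T. \<bar>c t\<bar>))))"
    by (simp only: of_real_prod[symmetric] exp_sum[OF fin, symmetric])
       (simp add: sum_distrib_left sum_negf)
  finally show ?thesis .
qed

lemma iexp_ma1:
  assumes iid: "iid_cauchy M \<delta> \<epsilon>"
  shows "(CLINT w|M. iexp (u * ma1 a \<epsilon> t w))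
    = complex_of_real (exp (- (\<delta> * (1 + \<bar>inverse a\<bar>) * \<bar>u\<bar>)))"
proof -
  let ?c = "\<lambda>s. if s = t then u else - (u * inverse a)"
  have comb: "(\<Sum>s\<in>{t, t - 1}. ?c s * \<epsilon> s w) = u * ma1 a \<epsilon> t w" for w
    by (simp add: ma1_def algebra_simps)
  have scale: "\<delta> * (\<Sum>s\<in>{t, t - 1}. \<bar>?c s\<bar>) = \<delta> * (1 + \<bar>inverse a\<bar>) * \<bar>u\<bar>"
    by (simp add: abs_mult algebra_simps)
  show ?thesis
    using iid_cauchy_iexp_linear_combination[OF iid, of "{t, t - 1}" ?c]
    unfolding comb scale by simp
qed

lemma iexp_ma1_mult:
  assumes iid: "iid_cauchy M \<delta> \<epsilon>"
  shows "(CLINT w|M. iexp (u * ma1 a \<epsilon> s w)) * (CLINT w|M. iexp (v * ma1 a \<epsilon> t w))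
    = complex_of_real (exp (- (\<delta> * (1 + \<bar>inverse a\<bar>) * (\<bar>u\<bar> + \<bar>v\<bar>))))"
  unfolding iexp_ma1[OF iid] of_real_mult[symmetric] mult_exp_exp
  by (simp only: distrib_left minus_add_distrib)

lemma iexp_ma1_adjacent:
  assumes iid: "iid_cauchy M \<delta> \<epsilon>"
  shows "(CLINT w|M. iexp (u * ma1 a \<epsilon> (t + 1) w + v * ma1 a \<epsilon> t w))
    = complex_of_real (exp (- (\<delta> * (\<bar>u\<bar> + \<bar>v - u * inverse a\<bar> + \<bar>v * inverse a\<bar>))))"
proof -
  let ?T = "{t + 1, t, t - 1}"
  let ?c = "\<lambda>s. if s = t + 1 then u else if s = t then v - u * inverse a else - (v * inverse a)"
  have comb: "(\<Sum>s\<in>?T. ?c s * \<epsilon> s w) = u * ma1 a \<epsilon> (t + 1) w + v * ma1 a \<epsilon> t w" for w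
    by (simp add: ma1_def algebra_simps)
  have scale: "(\<Sum>s\<in>?T. \<bar>?c s\<bar>) = \<bar>u\<bar> + \<bar>v - u * inverse a\<bar> + \<bar>v * inverse a\<bar>"
    by simp
  show ?thesis
    using iid_cauchy_iexp_linear_combination[OF iid, of ?T ?c]
    unfolding comb scale by simp
qed

lemma iexp_ma1_distant:
  assumes iid: "iid_cauchy M \<delta> \<epsilon>" and far: "s \<notin> {t - 1, t, t + 1}"
  shows "(CLINT w|M. iexp (u * ma1 a \<epsilon> s w + v * ma1 a \<epsilon> t w))
    = (CLINT w|M. iexp (u * ma1 a \<epsilon> s w)) * (CLINT w|M. iexp (v * ma1 a \<epsilon> t w))"
proof -
  let ?T = "{s, s - 1, t, t - 1}"
  let ?c = "\<lambda>r. if r = s then u else if r = s - 1 then - (u * inverse a)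
                else if r = t then v else - (v * inverse a)"
  have comb: "(\<Sum>r\<in>?T. ?c r * \<epsilon> r w) = u * ma1 a \<epsilon> s w + v * ma1 a \<epsilon> t w" for w
    using far by (auto simp: ma1_def algebra_simps)
  have scale: "\<delta> * (\<Sum>r\<in>?T. \<bar>?c r\<bar>) = \<delta> * (1 + \<bar>inverse a\<bar>) * (\<bar>u\<bar> + \<bar>v\<bar>)"
    using far by (auto simp: abs_mult algebra_simps)
  show ?thesis
    using iid_cauchy_iexp_linear_combination[OF iid, of ?T ?c]
    unfolding comb scale iexp_ma1_mult[OF iid] by simp
qed

lemma gen_cov_ma1_distant:
  assumes "iid_cauchy M \<delta> \<epsilon>" "l \<notin> {-1, 0, 1}"
  shows "gen_cov M (ma1 a \<epsilon>) 0 l u v = 0"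
  using iexp_ma1_distant[OF assms(1), of l 0] assms(2) by (simp add: gen_cov_def)

lemma gen_cov_ma1_lag0:
  assumes iid: "iid_cauchy M \<delta> \<epsilon>"
  shows "gen_cov M (ma1 a \<epsilon>) 0 0 u v
    = complex_of_real (exp (- (\<delta> * (1 + \<bar>inverse a\<bar>) * \<bar>u + v\<bar>))
        - exp (- (\<delta> * (1 + \<bar>inverse a\<bar>) * (\<bar>u\<bar> + \<bar>v\<bar>))))"
proof -
  have same_time: "u * ma1 a \<epsilon> (0 + 0) w + v * ma1 a \<epsilon> 0 w = (u + v) * ma1 a \<epsilon> 0 w" for w
    by (simp add: algebra_simps)
  show ?thesis
    unfolding gen_cov_def iexp_ma1_mult[OF iid]
    unfolding same_time iexp_ma1[OF iid] by simp
qed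

lemma gen_cov_ma1_lag1:
  assumes iid: "iid_cauchy M \<delta> \<epsilon>"
  shows "gen_cov M (ma1 a \<epsilon>) 0 1 u v
    = complex_of_real (exp (- (\<delta> * (\<bar>u\<bar> + \<bar>v - u * inverse a\<bar> + \<bar>v * inverse a\<bar>)))
        - exp (- (\<delta> * (1 + \<bar>inverse a\<bar>) * (\<bar>u\<bar> + \<bar>v\<bar>))))"
  unfolding gen_cov_def iexp_ma1_mult[OF iid] iexp_ma1_adjacent[OF iid] by simp

lemma gen_spectrum_ma1:
  assumes iid: "iid_cauchy M \<delta> \<epsilon>"
  shows "gen_spectrum M (ma1 a \<epsilon>) lam u v = complex_of_real (1 / (2 * pi)) *
    (gen_cov M (ma1 a \<epsilon>) 0 (-1) u v * iexp lam + gen_cov M (ma1 a \<epsilon>) 0 0 u v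
      + gen_cov M (ma1 a \<epsilon>) 0 1 u v * iexp (- lam))"
proof -
  let ?f = "\<lambda>l. gen_cov M (ma1 a \<epsilon>) 0 l u v * iexp (- (real_of_int l * lam))"
  have "infsum ?f UNIV = infsum ?f {-1, 0, 1}"
    by (rule infsum_cong_neutral) (auto simp: gen_cov_ma1_distant[OF iid])
  then show ?thesis
    by (simp add: gen_spectrum_def add.assoc)
qed

text \<open>
  Solves the linear system for the three Fourier coefficients, sampled at the frequencies
  \<open>0\<close>, \<open>\<pi> / 2\<close> and \<open>\<pi>\<close>: the values at \<open>0\<close> and \<open>\<pi>\<close> separate the middle coefficient from the sum
  of the outer ones, and \<open>\<pi> / 2\<close> gives the difference of the outer ones.
\<close>
lemma fourier_coefficients_degree1_unique:
  fixes p q r p' q' r' :: complex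
  assumes eq: "\<And>lam. lam \<in> {0..2 * pi} \<Longrightarrow>
    p * iexp lam + q + r * iexp (- lam) = p' * iexp lam + q' + r' * iexp (- lam)"
  shows "p = p'" "q = q'" "r = r'"
proof -
  have at_0: "p + q + r = p' + q' + r'"
    using eq[of 0] by simp
  have at_pi: "- p + q - r = - p' + q' - r'"
    using eq[of pi] by (simp add: exp_minus)
  have at_half_pi: "p * \<i> + q + r * - \<i> = p' * \<i> + q' + r' * - \<i>"
    using eq[of "pi / 2"] by (simp only: cis_conv_exp[symmetric] cis_minus_pi_half cis_pi_half) simp
  from at_0 at_pi show q: "q = q'" by algebra
  with at_half_pi have "(p - r) * \<i> = (p' - r') * \<i>"
    by (simp add: algebra_simps)
  then have diff: "p - r = p' - r'" by simp
  from at_0 q diff show "p = p'" by algebra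
  from at_0 q diff show "r = r'" by algebra
qed

text \<open>
  Here \<open>d\<close> and \<open>D\<close> are the scale parameter \<open>\<delta>\<close> and \<open>\<delta> / a\<close>. In these coordinates every quantity is piecewise
  linear, so the claim is linear arithmetic on each choice of signs.

  The points \<open>x = \<plusminus>1\<close> alone leave an ambiguity: together with the value of \<open>d + \<bar>D\<bar>\<close> they give the
  sign of \<open>D\<close> (as long as \<open>D \<noteq> 0\<close>) and the unordered pair \<open>{d, \<bar>D\<bar>}\<close>, since
  \<open>max \<bar>d - D\<bar> \<bar>d + D\<bar> = d + \<bar>D\<bar>\<close> and \<open>min \<bar>d - D\<bar> \<bar>d + D\<bar> = \<bar>d - \<bar>D\<bar>\<bar>\<close>. The points \<open>x = \<plusminus>2\<close> break the
  symmetry between \<open>d\<close> and \<open>\<bar>D\<bar>\<close>, which is the symmetry between \<open>1 / \<bar>a\<bar>\<close> and \<open>\<bar>a\<bar>\<close>.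
\<close>
lemma kink_parameters_determined:
  fixes d D d' D' :: real
  assumes pos: "d > 0" "d' > 0"
    and scale: "d + \<bar>D\<bar> = d' + \<bar>D'\<bar>"
    and kink: "\<And>x. x \<in> {-2, -1, 1, 2} \<Longrightarrow>
      d + \<bar>d * x - D\<bar> + \<bar>D * x\<bar> = d' + \<bar>d' * x - D'\<bar> + \<bar>D' * x\<bar>"
  shows "d = d'" "D = D'"
proof -
  have "\<bar>d - D\<bar> = \<bar>d' - D'\<bar>" "\<bar>- d - D\<bar> = \<bar>- d' - D'\<bar>"
       "\<bar>d * 2 - D\<bar> + \<bar>D\<bar> = \<bar>d' * 2 - D'\<bar> + \<bar>D'\<bar>"
       "\<bar>- (d * 2) - D\<bar> + \<bar>D\<bar> = \<bar>- (d' * 2) - D'\<bar> + \<bar>D'\<bar>"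
    using kink[of 1] kink[of "-1"] kink[of 2] kink[of "-2"] scale by (simp_all add: abs_mult)
  with pos scale show "d = d'" "D = D'"
    by (simp_all add: abs_if split: if_splits)
qed

theorem lemma1:
  fixes M :: "'w measure" and M' :: "'w2 measure"
    and \<epsilon> :: "int \<Rightarrow> 'w \<Rightarrow> real" and \<epsilon>' :: "int \<Rightarrow> 'w2 \<Rightarrow> real"
    and a a' \<delta> \<delta>' :: real
  assumes "a \<noteq> 0" "\<delta> > 0" "a' \<noteq> 0" "\<delta>' > 0"
    and "iid_cauchy M \<delta> \<epsilon>" "iid_cauchy M' \<delta>' \<epsilon>'"
    and "\<forall>lam\<in>{0..2 * pi}. \<forall>u\<in>{-pi..pi}. \<forall>v\<in>{-pi..pi}.
           gen_spectrum M (ma1 a \<epsilon>) lam u v = gen_spectrum M' (ma1 a' \<epsilon>') lam u v"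
  shows "(a, \<delta>) = (a', \<delta>')"
proof -
  note iid = assms(5) and iid' = assms(6)
  let ?D = "\<delta> * inverse a" and ?D' = "\<delta>' * inverse a'"
  have cov: "gen_cov M (ma1 a \<epsilon>) 0 0 u v = gen_cov M' (ma1 a' \<epsilon>') 0 0 u v"
            "gen_cov M (ma1 a \<epsilon>) 0 1 u v = gen_cov M' (ma1 a' \<epsilon>') 0 1 u v"
    if "u \<in> {-pi..pi}" "v \<in> {-pi..pi}" for u v
  proof -
    have "gen_cov M (ma1 a \<epsilon>) 0 (-1) u v * iexp lam + gen_cov M (ma1 a \<epsilon>) 0 0 u v
        + gen_cov M (ma1 a \<epsilon>) 0 1 u v * iexp (- lam)
      = gen_cov M' (ma1 a' \<epsilon>') 0 (-1) u v * iexp lam + gen_cov M' (ma1 a' \<epsilon>') 0 0 u v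
        + gen_cov M' (ma1 a' \<epsilon>') 0 1 u v * iexp (- lam)" if "lam \<in> {0..2 * pi}" for lam
    proof -
      have "complex_of_real (1 / (2 * pi)) \<noteq> 0" by simp
      then show ?thesis
        using assms(7) that \<open>u \<in> _\<close> \<open>v \<in> _\<close>
        unfolding gen_spectrum_ma1[OF iid] gen_spectrum_ma1[OF iid']
        using mult_left_cancel by blast
    qed
    from fourier_coefficients_degree1_unique(2,3)[OF this]
    show "gen_cov M (ma1 a \<epsilon>) 0 0 u v = gen_cov M' (ma1 a' \<epsilon>') 0 0 u v"
      "gen_cov M (ma1 a \<epsilon>) 0 1 u v = gen_cov M' (ma1 a' \<epsilon>') 0 1 u v"
      by blast+
  qed
  (* The box is large enough for the sample points because pi > 2. *)
  have box: "x \<in> {-pi..pi}" if "x \<in> {-2, -1, 1, 2}" for x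
    using that pi_gt3 by auto
  have c_eq: "\<delta> * (1 + \<bar>inverse a\<bar>) = \<delta>' * (1 + \<bar>inverse a'\<bar>)"
    using cov(1)[OF box box, of 1 "-1"]
    unfolding gen_cov_ma1_lag0[OF iid] gen_cov_ma1_lag0[OF iid'] of_real_eq_iff by simp
  have "\<delta> * (1 + \<bar>x - inverse a\<bar> + \<bar>x * inverse a\<bar>)
      = \<delta>' * (1 + \<bar>x - inverse a'\<bar> + \<bar>x * inverse a'\<bar>)" if "x \<in> {-2, -1, 1, 2}" for x
    using cov(2)[OF box box, of 1 x] that
    unfolding gen_cov_ma1_lag1[OF iid] gen_cov_ma1_lag1[OF iid'] of_real_eq_iff c_eq by simp
  moreover have "d * (1 + \<bar>x - i\<bar> + \<bar>x * i\<bar>) = d + \<bar>d * x - d * i\<bar> + \<bar>d * i * x\<bar>"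
    if "d > 0" for d x i :: real
    using that by (simp add: right_diff_distrib[symmetric] abs_mult distrib_left mult.commute mult.left_commute)
  ultimately have kink: "\<delta> + \<bar>\<delta> * x - ?D\<bar> + \<bar>?D * x\<bar> = \<delta>' + \<bar>\<delta>' * x - ?D'\<bar> + \<bar>?D' * x\<bar>"
    if "x \<in> {-2, -1, 1, 2}" for x
    using that assms(2,4) by metis
  have scale: "\<delta> + \<bar>?D\<bar> = \<delta>' + \<bar>?D'\<bar>"
    using c_eq assms(2,4) by (simp add: abs_mult distrib_left)
  have "\<delta> = \<delta>'" "?D = ?D'"
    using kink_parameters_determined[OF assms(2,4) scale kink] by auto
  with assms(2) show ?thesis by simp
qed

end
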